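(* Let $X=(X_1,\dots,X_d)\in\mathbb{R}^d$ be a random vector, let $0\le k\le d$, let the objective be squared recovery (action set $\mathbb{R}^d$, loss $\ell(a,x)=\|a-x\|_2^2$), and let $\mu_i=\mathbb{E}[X_i]$. Assume there exists $\varepsilon\ge0$ such that for every $i\in[d]$, every set $S\subseteq[d]\setminus\{i\}$ with $|S|\le k$, and every value $x_S$, $$\bigl|\mathbb{E}[X_i\mid X_S=x_S]-\mathbb{E}[X_i]\bigr|\le\varepsilon.$$ Assume additionally that $X_i\in[a_i,b_i]$ almost surely, and let $R:=\max_i(b_i-a_i)$. Let $\sigma^{\mathrm{dev}}$ be the deviation policy, and let $\sigma^N$ be a naive-optimal policy among all policies that reveal at most $k$ coordinates (and may reveal none). Then $$R^N(\sigma^{\mathrm{dev}})\ \le\ R^N(\sigma^N)+2(d-k)\cdot(2R\varepsilon+\varepsilon^2).$$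
   Context: A highlighting policy $\sigma$ maps each realized instance $x$ to a set $I=\sigma(x)\subseteq[d]$ with $|I|\le k$; the agent observes $I$ and $X_I=(X_i)_{i\in I}$. The naive agent forms the belief $\mathbb{P}(\cdot\mid X_I)$, ignoring the information contained in the selection of $I$, and plays the Bayes action; under squared loss this is the vector $\hat a$ with $\hat a_i=x_i$ for $i\in I$ and $\hat a_i=\mathbb{E}[X_i\mid X_I=x_I]$ for $i\notin I$, where the conditional expectation is for a non-adaptively chosen index set $I$. The naive risk is $R^N(\sigma)=\mathbb{E}\big[\sum_{i\notin I}(X_i-m_i(I,X_I))^2\big]$, where $I=\sigma(X)$ and $m_i(I,x_I):=\mathbb{E}[X_i\mid X_I=x_I]$. A naive-optimal policy is a minimizer of $R^N$ over all policies with $|\sigma(x)|\le k$. Deviation policy $\sigma^{\mathrm{dev}}$: for each $x$, it reveals the $k$ coordinates with the largest scores $|x_i-\mu_i|$, ties broken in favor of the smallest index. *)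

theory Defs
  imports "HOL-Probability.Probability"
begin

text \<open>
  Instances are vectors in \<open>\<real>\<^sup>d\<close>, represented as extensional functions on \<open>[d] = {1..d}\<close>;
  \<open>X_S\<close> is \<open>restrict x S\<close>, a point of the product space over \<open>S\<close>.
\<close>

abbreviation coords :: "nat set \<Rightarrow> (nat \<Rightarrow> real) measure" where
  "coords S \<equiv> PiM S (\<lambda>_. borel)"

definition mean :: "'a measure \<Rightarrow> ('a \<Rightarrow> nat \<Rightarrow> real) \<Rightarrow> nat \<Rightarrow> real" where
  "mean M X i = (\<integral>\<omega>. X \<omega> i \<partial>M)"

text \<open>
  Conditional expectations are only determined almost everywhere.  The predicate below says that
  \<open>m i S\<close>, as a measurable function of the value \<open>x_S\<close>, is some version of \<open>E[X_i | X_S = x_S]\<close>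
  for each non-adaptively chosen index set \<open>S\<close>.
\<close>

definition cond_mean_version ::
    "'a measure \<Rightarrow> ('a \<Rightarrow> nat \<Rightarrow> real) \<Rightarrow> nat \<Rightarrow> (nat \<Rightarrow> nat set \<Rightarrow> (nat \<Rightarrow> real) \<Rightarrow> real) \<Rightarrow> bool" where
  "cond_mean_version M X d m \<longleftrightarrow>
     (\<forall>i\<in>{1..d}. \<forall>S. S \<subseteq> {1..d} \<longrightarrow>
        m i S \<in> borel_measurable (coords S) \<and>
        (AE \<omega> in M. m i S (restrict (X \<omega>) S) =
           real_cond_exp M
             (vimage_algebra (space M) (\<lambda>\<omega>. restrict (X \<omega>) S) (coords S))
             (\<lambda>\<omega>. X \<omega> i) \<omega>))"

definition is_policy :: "nat \<Rightarrow> nat \<Rightarrow> ((nat \<Rightarrow> real) \<Rightarrow> nat set) \<Rightarrow> bool" where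
  "is_policy d k \<sigma> \<longleftrightarrow>
     \<sigma> \<in> coords {1..d} \<rightarrow>\<^sub>M count_space (Pow {1..d}) \<and>
     (\<forall>x\<in>space (coords {1..d}). card (\<sigma> x) \<le> k)"

definition sq_loss :: "nat \<Rightarrow> (nat \<Rightarrow> real) \<Rightarrow> (nat \<Rightarrow> real) \<Rightarrow> real" where
  "sq_loss d a x = (\<Sum>i\<in>{1..d}. (a i - x i)\<^sup>2)"

definition naive_action ::
    "(nat \<Rightarrow> nat set \<Rightarrow> (nat \<Rightarrow> real) \<Rightarrow> real) \<Rightarrow> nat set \<Rightarrow> (nat \<Rightarrow> real) \<Rightarrow> nat \<Rightarrow> real" where
  "naive_action m I xI i = (if i \<in> I then xI i else m i I xI)"

definition naive_risk ::
    "'a measure \<Rightarrow> ('a \<Rightarrow> nat \<Rightarrow> real) \<Rightarrow> nat \<Rightarrow> (nat \<Rightarrow> nat set \<Rightarrow> (nat \<Rightarrow> real) \<Rightarrow> real)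
     \<Rightarrow> ((nat \<Rightarrow> real) \<Rightarrow> nat set) \<Rightarrow> real" where
  "naive_risk M X d m \<sigma> =
     (\<integral>\<omega>. (\<Sum>i\<in>{1..d} - \<sigma> (X \<omega>). (X \<omega> i - m i (\<sigma> (X \<omega>)) (restrict (X \<omega>) (\<sigma> (X \<omega>))))\<^sup>2) \<partial>M)"

lemma naive_risk_eq_expected_loss:
  "naive_risk M X d m \<sigma> =
     (\<integral>\<omega>. sq_loss d (naive_action m (\<sigma> (X \<omega>)) (restrict (X \<omega>) (\<sigma> (X \<omega>)))) (X \<omega>) \<partial>M)"
proof -
  have "(\<Sum>i\<in>{1..d} - I. (x i - m i I (restrict x I))\<^sup>2) =
        sq_loss d (naive_action m I (restrict x I)) x" for x and I :: "nat set"
    unfolding sq_loss_def naive_action_def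
    by (rule sum.mono_neutral_cong_left) (auto simp: power2_commute)
  then show ?thesis by (simp add: naive_risk_def)
qed

definition naive_optimal ::
    "'a measure \<Rightarrow> ('a \<Rightarrow> nat \<Rightarrow> real) \<Rightarrow> nat \<Rightarrow> nat \<Rightarrow> (nat \<Rightarrow> nat set \<Rightarrow> (nat \<Rightarrow> real) \<Rightarrow> real)
     \<Rightarrow> ((nat \<Rightarrow> real) \<Rightarrow> nat set) \<Rightarrow> bool" where
  "naive_optimal M X d k m \<sigma> \<longleftrightarrow>
     is_policy d k \<sigma> \<and>
     (\<forall>\<tau>. is_policy d k \<tau> \<longrightarrow> naive_risk M X d m \<sigma> \<le> naive_risk M X d m \<tau>)"

text \<open>
  Sorting is stable, so among equal scores the smaller index comes first.
\<close>

definition dev_policy :: "nat \<Rightarrow> nat \<Rightarrow> (nat \<Rightarrow> real) \<Rightarrow> (nat \<Rightarrow> real) \<Rightarrow> nat set" where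
  "dev_policy d k \<mu> x = set (take k (sort_key (\<lambda>i. - \<bar>x i - \<mu> i\<bar>) [1..<Suc d]))"

end

theory Submission
  imports Defs
begin

text \<open>
  Where \<open>|m - \<mu>| \<le> \<epsilon>\<close> and \<open>|x - \<mu>| \<le> R\<close>, replacing the
  conditional mean \<open>m\<close> by \<open>\<mu>\<close> changes the squared error of a hidden coordinate by at most
  \<open>2 R \<epsilon> + \<epsilon>\<^sup>2\<close>.  With \<open>\<mu>\<close> in place of \<open>m\<close>, the deviation policy is optimal pointwise, since it
  hides the \<open>d - k\<close> smallest squared deviations.  A competing policy may hide more than \<open>d - k\<close>
  coordinates; its terms beyond \<open>d - k\<close> of them are nonnegative and are dropped before the
  comparison, so that both replacements cost only \<open>d - k\<close> times the error.
\<close>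

text \<open>The common part \<open>B \<inter> J\<close> contributes equally to both sums. The two
  differences have equal cardinality, and any bijection from \<open>B - J\<close> to
  \<open>J - B\<close> can only increase \<open>f\<close>.\<close>

lemma sum_le_of_card_eq_separated:
  fixes f :: "'b \<Rightarrow> real"
  assumes "finite B" "finite J" "card B = card J"
    and sep: "\<And>b j. b \<in> B \<Longrightarrow> j \<in> J - B \<Longrightarrow> f b \<le> f j"
  shows "sum f B \<le> sum f J"
proof -
  have "card (B - J) = card (J - B)"
    using card_Diff_subset_Int[of B J] card_Diff_subset_Int[of J B] assms
    by (simp add: Int_commute)
  then obtain h where h: "bij_betw h (B - J) (J - B)"
    using assms by (metis finite_Diff finite_same_card_bij)
  have "sum f (B - J) \<le> (\<Sum>i\<in>B - J. f (h i))"
    using h by (intro sum_mono sep) (auto simp: bij_betw_def)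
  also have "\<dots> = sum f (J - B)" by (rule sum.reindex_bij_betw[OF h])
  finally have "sum f (B - J) + sum f (B \<inter> J) \<le> sum f (J - B) + sum f (J \<inter> B)"
    by (simp add: Int_commute)
  then show ?thesis
    using assms by (simp add: sum.Int_Diff[of B f J] sum.Int_Diff[of J f B])
qed

lemma dev_policy_subset: "dev_policy d k \<mu> x \<subseteq> {1..d}"
  unfolding dev_policy_def by (auto dest!: in_set_takeD)

lemma card_dev_policy: "k \<le> d \<Longrightarrow> card (dev_policy d k \<mu> x) = k"
  unfolding dev_policy_def by (subst distinct_card) auto

text \<open>Cutting a sorted list at position \<open>k\<close> leaves no key before the cut above a
  key after it. The keys are negated deviations, so the inequality reverses.\<close>

lemma dev_policy_largest:
  assumes "i \<in> dev_policy d k \<mu> x" "j \<in> {1..d} - dev_policy d k \<mu> x"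
  shows "\<bar>x j - \<mu> j\<bar> \<le> \<bar>x i - \<mu> i\<bar>"
proof -
  define f where "f = (\<lambda>i. - \<bar>x i - \<mu> i\<bar>)"
  define xs where "xs = sort_key f [1..<Suc d]"
  have "set xs = {1..d}" by (auto simp: xs_def)
  then have "i \<in> set (take k xs)" "j \<in> set (drop k xs)"
    using assms append_take_drop_id[of k xs] set_append[of "take k xs" "drop k xs"]
    by (auto simp: dev_policy_def xs_def f_def simp del: append_take_drop_id set_append)
  moreover have "sorted (map f (take k xs) @ map f (drop k xs))"
    unfolding map_append[symmetric] append_take_drop_id by (simp add: xs_def)
  ultimately have "f i \<le> f j" by (auto simp: sorted_append)
  then show ?thesis by (simp add: f_def)
qed

lemma sum_hidden_dev_policy_le:
  fixes x \<mu> :: "nat \<Rightarrow> real"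
  assumes "k \<le> d" "J \<subseteq> {1..d}" "card J = d - k"
  shows "(\<Sum>i\<in>{1..d} - dev_policy d k \<mu> x. (x i - \<mu> i)\<^sup>2) \<le> (\<Sum>i\<in>J. (x i - \<mu> i)\<^sup>2)"
proof (rule sum_le_of_card_eq_separated)
  show "finite J" using assms finite_subset by blast
  show "card ({1..d} - dev_policy d k \<mu> x) = card J"
    using assms card_dev_policy[of k d \<mu> x] dev_policy_subset[of d k \<mu> x]
    by (subst card_Diff_subset) (auto intro: finite_subset)
  fix i j
  \<comment> \<open>Here \<open>j\<close> lies in \<open>J\<close> but is not hidden by the
    deviation policy, so that policy reveals it.\<close>
  assume "i \<in> {1..d} - dev_policy d k \<mu> x" "j \<in> J - ({1..d} - dev_policy d k \<mu> x)"
  then have "\<bar>x i - \<mu> i\<bar> \<le> \<bar>x j - \<mu> j\<bar>"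
    using assms dev_policy_largest by blast
  then show "(x i - \<mu> i)\<^sup>2 \<le> (x j - \<mu> j)\<^sup>2" by (rule abs_le_square_iff[THEN iffD1])
qed simp

text \<open>The difference of squares factors as \<open>y - z\<close> times a term of size at most
  \<open>\<epsilon> + 2 * R\<close>.\<close>

lemma square_diff_perturb:
  fixes x y z :: real
  assumes "\<bar>y - z\<bar> \<le> \<epsilon>" "\<bar>x - z\<bar> \<le> R"
  shows "\<bar>(x - y)\<^sup>2 - (x - z)\<^sup>2\<bar> \<le> 2 * R * \<epsilon> + \<epsilon>\<^sup>2"
proof -
  have "(x - y)\<^sup>2 - (x - z)\<^sup>2 = (y - z) * ((y - z) - 2 * (x - z))"
    by (simp add: power2_eq_square algebra_simps)
  then have "\<bar>(x - y)\<^sup>2 - (x - z)\<^sup>2\<bar> = \<bar>y - z\<bar> * \<bar>(y - z) - 2 * (x - z)\<bar>"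
    by (simp add: abs_mult)
  also have "\<dots> \<le> \<epsilon> * (\<epsilon> + 2 * R)" using assms by (intro mult_mono) auto
  finally show ?thesis by (simp add: power2_eq_square algebra_simps)
qed

text \<open>The expectation lies in the same interval as almost every value.\<close>

lemma (in prob_space) abs_diff_expectation_le:
  fixes f :: "'a \<Rightarrow> real"
  assumes "f \<in> borel_measurable M" "AE \<omega> in M. f \<omega> \<in> {a..b}"
  shows "AE \<omega> in M. \<bar>f \<omega> - expectation f\<bar> \<le> b - a"
proof -
  have int: "integrable M f"
    using assms by (intro integrable_const_bound[where B = "max \<bar>a\<bar> \<bar>b\<bar>"]) auto
  have "a \<le> expectation f" using assms by (intro integral_ge_const int) auto
  moreover have "expectation f \<le> b" using assms by (intro integral_le_const int) auto
  ultimately show ?thesis using assms(2) by auto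
qed

abbreviation (input) naive_loss ::
    "nat \<Rightarrow> (nat \<Rightarrow> nat set \<Rightarrow> (nat \<Rightarrow> real) \<Rightarrow> real) \<Rightarrow> nat set \<Rightarrow> (nat \<Rightarrow> real) \<Rightarrow> real" where
  "naive_loss d m I x \<equiv> (\<Sum>i\<in>{1..d} - I. (x i - m i I (restrict x I))\<^sup>2)"

text \<open>The comparison of risks for one fixed instance \<open>x\<close>, free of probability:
  \<open>cond\<close> and \<open>bound\<close> are to be supplied outside a null set, after which
  only integration remains.\<close>

lemma naive_loss_dev_policy_le:
  fixes x \<mu> :: "nat \<Rightarrow> real"
  assumes "k \<le> d" "I \<subseteq> {1..d}" "card I \<le> k"
    and cond: "\<And>i S. i \<in> {1..d} \<Longrightarrow> S \<subseteq> {1..d} - {i} \<Longrightarrow> card S \<le> k \<Longrightarrow>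
                 \<bar>m i S (restrict x S) - \<mu> i\<bar> \<le> \<epsilon>"
    and bound: "\<And>i. i \<in> {1..d} \<Longrightarrow> \<bar>x i - \<mu> i\<bar> \<le> R"
  shows "naive_loss d m (dev_policy d k \<mu> x) x
           \<le> naive_loss d m I x + 2 * (real d - real k) * (2 * R * \<epsilon> + \<epsilon>\<^sup>2)"
proof -
  define D where "D = dev_policy d k \<mu> x"
  define c where "c = 2 * R * \<epsilon> + \<epsilon>\<^sup>2"
  have D: "D \<subseteq> {1..d}" "card D = k"
    using dev_policy_subset card_dev_policy assms(1) by (auto simp: D_def)
  have err: "\<bar>(x i - m i S (restrict x S))\<^sup>2 - (x i - \<mu> i)\<^sup>2\<bar> \<le> c"
    if "i \<in> {1..d} - S" "S \<subseteq> {1..d}" "card S \<le> k" for i S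
    unfolding c_def using that by (intro square_diff_perturb cond bound) auto
  have "card ({1..d} - D) = d - k"
    using D by (subst card_Diff_subset) (auto intro: finite_subset)
  have "d - k \<le> card ({1..d} - I)"
    using assms by (subst card_Diff_subset) (auto intro: finite_subset)
  then obtain J where J: "J \<subseteq> {1..d} - I" "card J = d - k" "finite J"
    by (rule obtain_subset_with_card_n)
  have "naive_loss d m D x \<le> (\<Sum>i\<in>{1..d} - D. (x i - \<mu> i)\<^sup>2 + c)"
    using err[of _ D] D by (intro sum_mono) (force simp: abs_le_iff)
  also have "\<dots> = (\<Sum>i\<in>{1..d} - D. (x i - \<mu> i)\<^sup>2) + (real d - real k) * c"
    using \<open>card ({1..d} - D) = d - k\<close> assms(1) by (simp add: sum.distrib of_nat_diff)
  also have "(\<Sum>i\<in>{1..d} - D. (x i - \<mu> i)\<^sup>2) \<le> (\<Sum>i\<in>J. (x i - \<mu> i)\<^sup>2)"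
    unfolding D_def using J assms(1) by (intro sum_hidden_dev_policy_le) auto
  also have "\<dots> \<le> (\<Sum>i\<in>J. (x i - m i I (restrict x I))\<^sup>2 + c)"
    using err[of _ I] J assms(2,3) by (intro sum_mono) (force simp: abs_le_iff)
  also have "\<dots> = (\<Sum>i\<in>J. (x i - m i I (restrict x I))\<^sup>2) + (real d - real k) * c"
    using J assms(1) by (simp add: sum.distrib of_nat_diff)
  also have "(\<Sum>i\<in>J. (x i - m i I (restrict x I))\<^sup>2) \<le> naive_loss d m I x"
    using J by (intro sum_mono2) auto
  \<comment> \<open>Estimates applied to the first summand alone leave monotonicity premises in the
    calculation; \<open>simp_all\<close> discharges them.\<close>
  finally have "naive_loss d m D x
      \<le> naive_loss d m I x + (real d - real k) * c + (real d - real k) * c"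
    by this simp_all
  then show ?thesis unfolding D_def[symmetric] c_def[symmetric] by linarith
qed

text \<open>A policy takes finitely many values, so the loss is glued from the losses for constant
  sets \<open>S\<close>, each measurable in \<omega>.\<close>

lemma measurable_naive_loss:
  assumes X: "X \<in> M \<rightarrow>\<^sub>M coords {1..d}"
    and m: "\<And>i S. i \<in> {1..d} \<Longrightarrow> S \<subseteq> {1..d} \<Longrightarrow> m i S \<in> borel_measurable (coords S)"
    and \<sigma>: "\<sigma> \<in> coords {1..d} \<rightarrow>\<^sub>M count_space (Pow {1..d})"
  shows "(\<lambda>\<omega>. naive_loss d m (\<sigma> (X \<omega>)) (X \<omega>)) \<in> borel_measurable M"
proof (rule measurable_compose_countable'[where I = "Pow {1..d}"
      and f = "\<lambda>S \<omega>. naive_loss d m S (X \<omega>)" and g = "\<lambda>\<omega>. \<sigma> (X \<omega>)"])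
  fix S assume S: "S \<in> Pow {1..d}"
  have "(\<lambda>\<omega>. restrict (X \<omega>) S) \<in> M \<rightarrow>\<^sub>M coords S"
    using S by (intro measurable_compose[OF X] measurable_restrict_subset) auto
  then have "(\<lambda>\<omega>. m i S (restrict (X \<omega>) S)) \<in> borel_measurable M" if "i \<in> {1..d} - S" for i
    using that S m by (intro measurable_compose[OF _ m]) auto
  moreover have "(\<lambda>\<omega>. X \<omega> i) \<in> borel_measurable M" if "i \<in> {1..d} - S" for i
    using that by (intro measurable_compose[OF X] measurable_component_singleton) auto
  ultimately show "(\<lambda>\<omega>. naive_loss d m S (X \<omega>)) \<in> borel_measurable M"
    by (intro borel_measurable_sum borel_measurable_power borel_measurable_diff)
qed (use measurable_compose[OF X \<sigma>] in \<open>auto intro: countable_finite\<close>)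

theorem proposition4:
  fixes M :: "'a measure" and X :: "'a \<Rightarrow> nat \<Rightarrow> real" and d k :: nat
    and m :: "nat \<Rightarrow> nat set \<Rightarrow> (nat \<Rightarrow> real) \<Rightarrow> real"
    and a b :: "nat \<Rightarrow> real" and \<epsilon> R :: real
    and \<sigma>N :: "(nat \<Rightarrow> real) \<Rightarrow> nat set"
  assumes "prob_space M"
    and "X \<in> M \<rightarrow>\<^sub>M coords {1..d}"
    and "k \<le> d"
    and "cond_mean_version M X d m"
    and "\<epsilon> \<ge> 0"
    and "\<And>i S. i \<in> {1..d} \<Longrightarrow> S \<subseteq> {1..d} - {i} \<Longrightarrow> card S \<le> k \<Longrightarrow>
           AE xS in distr M (coords S) (\<lambda>\<omega>. restrict (X \<omega>) S). \<bar>m i S xS - mean M X i\<bar> \<le> \<epsilon>"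
    and "\<And>i. i \<in> {1..d} \<Longrightarrow> AE \<omega> in M. X \<omega> i \<in> {a i..b i}"
    and "R = Max ((\<lambda>i. b i - a i) ` {1..d})"
    and "naive_optimal M X d k m \<sigma>N"
  shows "naive_risk M X d m (dev_policy d k (mean M X))
           \<le> naive_risk M X d m \<sigma>N + 2 * (real d - real k) * (2 * R * \<epsilon> + \<epsilon>\<^sup>2)"
proof -
  interpret prob_space M by fact
  define c where "c = 2 * (real d - real k) * (2 * R * \<epsilon> + \<epsilon>\<^sup>2)"
  have \<sigma>N: "\<sigma>N \<in> coords {1..d} \<rightarrow>\<^sub>M count_space (Pow {1..d})"
      "\<And>x. x \<in> space (coords {1..d}) \<Longrightarrow> card (\<sigma>N x) \<le> k"
    using assms(9) by (auto simp: naive_optimal_def is_policy_def)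
  \<comment> \<open>The inclusion comes from the space of the target measure,
    \<open>count_space (Pow {1..d})\<close>.\<close>
  have pol: "\<sigma>N (X \<omega>) \<subseteq> {1..d} \<and> card (\<sigma>N (X \<omega>)) \<le> k" if "\<omega> \<in> space M" for \<omega>
    using measurable_space[OF assms(2) that] measurable_space[OF \<sigma>N(1)] \<sigma>N(2) by auto
  have m: "m i S \<in> borel_measurable (coords S)" if "i \<in> {1..d}" "S \<subseteq> {1..d}" for i S
    using assms(4) that by (auto simp: cond_mean_version_def)
  have "AE \<omega> in M. \<bar>X \<omega> i - mean M X i\<bar> \<le> R" if i: "i \<in> {1..d}" for i
  proof -
    have "b i - a i \<le> R" unfolding assms(8) using i by (intro Max_ge) auto
    moreover have "(\<lambda>\<omega>. X \<omega> i) \<in> borel_measurable M"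
      by (intro measurable_compose[OF assms(2)] measurable_component_singleton i)
    ultimately show ?thesis
      using abs_diff_expectation_le[OF _ assms(7)[OF i]] by (fastforce simp: mean_def)
  qed
  then have AE_bound: "AE \<omega> in M. \<forall>i\<in>{1..d}. \<bar>X \<omega> i - mean M X i\<bar> \<le> R"
    by (intro AE_finite_allI) auto
  have "AE \<omega> in M. \<bar>m i S (restrict (X \<omega>) S) - mean M X i\<bar> \<le> \<epsilon>"
    if "i \<in> {1..d}" "S \<subseteq> {1..d} - {i}" "card S \<le> k" for i S
    using that by (intro AE_distrD[OF _ assms(6)] measurable_compose[OF assms(2)]
        measurable_restrict_subset) auto
  \<comment> \<open>A policy picks \<open>S\<close> depending on \<omega>, so a single null set must
    serve all pairs of \<open>i\<close> and \<open>S\<close>. There are finitely many pairs, so the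
    union of their null sets is null.\<close>
  then have "AE \<omega> in M. \<forall>i\<in>{1..d}. \<forall>S\<in>{S. S \<subseteq> {1..d} - {i} \<and> card S \<le> k}.
      \<bar>m i S (restrict (X \<omega>) S) - mean M X i\<bar> \<le> \<epsilon>"
    by (intro AE_finite_allI) auto
  then have AE_all: "AE \<omega> in M. \<omega> \<in> space M \<and>
      (\<forall>i\<in>{1..d}. \<bar>X \<omega> i - mean M X i\<bar> \<le> R) \<and>
      (\<forall>i\<in>{1..d}. \<forall>S. S \<subseteq> {1..d} - {i} \<longrightarrow> card S \<le> k \<longrightarrow>
        \<bar>m i S (restrict (X \<omega>) S) - mean M X i\<bar> \<le> \<epsilon>)"
    using AE_bound AE_space by eventually_elim auto
  \<comment> \<open>A uniform bound gives integrability, without which the integral would default to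
    0. Each hidden term is at most \<open>(R + \<epsilon>)\<^sup>2\<close> by the triangle
    inequality through the mean.\<close>
  have "AE \<omega> in M. norm (naive_loss d m (\<sigma>N (X \<omega>)) (X \<omega>)) \<le> real d * (R + \<epsilon>)\<^sup>2"
    using AE_all
  proof eventually_elim
    case (elim \<omega>)
    let ?I = "\<sigma>N (X \<omega>)"
    have I: "?I \<subseteq> {1..d}" "card ?I \<le> k" using elim pol by auto
    have "(X \<omega> i - m i ?I (restrict (X \<omega>) ?I))\<^sup>2 \<le> (R + \<epsilon>)\<^sup>2" if "i \<in> {1..d} - ?I" for i
    proof -
      have "\<bar>X \<omega> i - mean M X i\<bar> \<le> R" "\<bar>m i ?I (restrict (X \<omega>) ?I) - mean M X i\<bar> \<le> \<epsilon>"
        using elim I that by (simp, blast)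
      then show ?thesis by (intro abs_le_square_iff[THEN iffD1]) arith
    qed
    then have "naive_loss d m ?I (X \<omega>) \<le> real (card ({1..d} - ?I)) * (R + \<epsilon>)\<^sup>2"
      by (intro sum_bounded_above)
    also have "\<dots> \<le> real d * (R + \<epsilon>)\<^sup>2"
      using card_mono[of "{1..d}" "{1..d} - ?I"] by (intro mult_right_mono) auto
    finally show ?case by (simp add: sum_nonneg)
  qed
  then have int: "integrable M (\<lambda>\<omega>. naive_loss d m (\<sigma>N (X \<omega>)) (X \<omega>))"
    by (intro integrable_const_bound measurable_naive_loss assms(2) m \<sigma>N(1))
  have le: "AE \<omega> in M. naive_loss d m (dev_policy d k (mean M X) (X \<omega>)) (X \<omega>)
      \<le> naive_loss d m (\<sigma>N (X \<omega>)) (X \<omega>) + c"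
    using AE_all
  proof eventually_elim
    case (elim \<omega>)
    then show ?case
      unfolding c_def using pol by (intro naive_loss_dev_policy_le assms(3)) blast+
  qed
  have "naive_risk M X d m (dev_policy d k (mean M X))
      \<le> (\<integral>\<omega>. naive_loss d m (\<sigma>N (X \<omega>)) (X \<omega>) + c \<partial>M)"
    unfolding naive_risk_def
    \<comment> \<open>Valid even if the left integrand is not measurable: its integral is then 0, and the
      right integrand is nonnegative.\<close>
  proof (rule integral_mono_AE')
    show "integrable M (\<lambda>\<omega>. naive_loss d m (\<sigma>N (X \<omega>)) (X \<omega>) + c)" using int by simp
    \<comment> \<open>Nonnegativity is read off from \<open>le\<close>, whose left side is a sum of
      squares, rather than from the sign of \<open>c\<close>.\<close>
    show "AE \<omega> in M. 0 \<le> naive_loss d m (\<sigma>N (X \<omega>)) (X \<omega>) + c"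
      using le by eventually_elim (rule order_trans[OF sum_nonneg], simp_all)
  qed (rule le)
  also have "\<dots> = naive_risk M X d m \<sigma>N + c"
    using int by (simp add: naive_risk_def prob_space)
  finally show ?thesis unfolding c_def .
qed

end
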